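(* Let $1\le k\le n-1$ and let $w\in\mathfrak{S}_n$ be the permutation $(w(1),\dots,w(n))=(n-k+1,\dots,n,1,\dots,n-k)$, the maximal element of the set of minimal left coset representatives of $\mathfrak{S}_n$ modulo the parabolic subgroup generated by $\{s_1,\dots,s_{n-1}\}\setminus\{s_k\}$. Then the number of elements of the Bruhat interval $[\mathrm{id},w]$ is \[|[\mathrm{id},w]|=\sum_{i=0}^{k}S_{k+1,i+1}\,S_{n-k+1,i+1}\,(i!)^2=(-1)^k\sum_{i=0}^{k}(-1)^i(i+1)^{n-k}\,i!\,S_{k,i}=B_k^{(k-n)},\] where $S_{a,b}$ are the Stirling numbers of the second kind and $B_m^{(j)}$ are Kaneko's poly-Bernoulli numbers.
   Context: $s_i$ denotes the adjacent transposition $(i\ i{+}1)$ in $\mathfrak{S}_n$, and Bruhat order is the usual one. $S_{a,b}$ is the Stirling number of the second kind (with $S_{0,0}=1$, $S_{a,0}=0$ for $a>0$). For an integer $j$, the poly-Bernoulli numbers $B_m^{(j)}$ ($m\ge0$) of Kaneko are defined by $\sum_{m\ge0}B_m^{(j)}\frac{x^m}{m!}=\frac{\mathrm{Li}_j(1-e^{-x})}{1-e^{-x}}$, where $\mathrm{Li}_j(z)=\sum_{r\ge1}z^r/r^j$. *)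

theory Defs
  imports
    "HOL-Algebra.Sym_Groups"
    "HOL-Combinatorics.Stirling"
    "HOL-Computational_Algebra.Formal_Power_Series"
begin

(* The Coxeter length of a permutation of {1..n} is its number of inversions. *)
definition perm_length :: "nat \<Rightarrow> (nat \<Rightarrow> nat) \<Rightarrow> nat" where
  "perm_length n u = card {(i, j). 1 \<le> i \<and> i < j \<and> j \<le> n \<and> u i > u j}"

definition bruhat_step :: "nat \<Rightarrow> (nat \<Rightarrow> nat) \<Rightarrow> (nat \<Rightarrow> nat) \<Rightarrow> bool" where
  "bruhat_step n u v \<longleftrightarrow>
     u \<in> carrier (sym_group n) \<and>
     (\<exists>a b. 1 \<le> a \<and> a < b \<and> b \<le> n \<and> v = u \<otimes>\<^bsub>sym_group n\<^esub> transpose a b) \<and>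
     perm_length n u < perm_length n v"

definition bruhat_le :: "nat \<Rightarrow> (nat \<Rightarrow> nat) \<Rightarrow> (nat \<Rightarrow> nat) \<Rightarrow> bool" where
  "bruhat_le n = (bruhat_step n)\<^sup>*\<^sup>*"

definition bruhat_interval :: "nat \<Rightarrow> (nat \<Rightarrow> nat) \<Rightarrow> (nat \<Rightarrow> nat) \<Rightarrow> (nat \<Rightarrow> nat) set" where
  "bruhat_interval n u v = {x \<in> carrier (sym_group n). bruhat_le n u x \<and> bruhat_le n x v}"

definition adj_transp :: "nat \<Rightarrow> nat \<Rightarrow> nat" where
  "adj_transp i = transpose i (i + 1)"

definition parabolic :: "nat \<Rightarrow> nat set \<Rightarrow> (nat \<Rightarrow> nat) set" where
  "parabolic n J = generate (sym_group n) (adj_transp ` J)"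

(* The elements v of minimal length in their left coset v W_J. *)
definition min_left_coset_reps :: "nat \<Rightarrow> nat set \<Rightarrow> (nat \<Rightarrow> nat) set" where
  "min_left_coset_reps n J =
     {v \<in> carrier (sym_group n).
        \<forall>u \<in> v <#\<^bsub>sym_group n\<^esub> parabolic n J. perm_length n v \<le> perm_length n u}"

definition fps_Li :: "int \<Rightarrow> rat fps" where
  "fps_Li j = Abs_fps (\<lambda>r. if r = 0 then 0 else 1 / (of_nat r powi j))"

(* The divisor has zero constant term; the quotient is nevertheless the exact one, because the
   composition in the numerator is a multiple of the divisor. *)
definition poly_bernoulli :: "int \<Rightarrow> nat \<Rightarrow> rat" where
  "poly_bernoulli j m =
     fact m * fps_nth ((fps_Li j oo (1 - fps_exp (-1))) / (1 - fps_exp (-1))) m"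

end

theory Submission
  imports Defs
begin

text \<open>The interval below \<open>w\<close> consists of the permutations \<open>u\<close> with \<open>i - k \<le> u i \<le> i + n - k\<close>:
  this condition is inherited by smaller elements, and any \<open>u \<noteq> w\<close> satisfying it can be raised by a
  transposition without violating it. Cut the permutation matrix of such a \<open>u\<close> after row \<open>k\<close> and
  column \<open>n - k\<close>. The condition only restricts the upper right and the lower left block, both to
  triangles, in which rook placements are counted by Stirling numbers. If the upper left block
  contains \<open>i\<close> rooks, then so does the lower right one, and these can be completed in \<open>(i!)\<^sup>2\<close> ways.\<close>

subsection \<open>Stirling number identities\<close>

text \<open>The bounds come from \<open>w\<close> itself: the displacement \<open>w i - i\<close> is
  \<open>n - k\<close> for \<open>i \<le> k\<close> and \<open>-k\<close> for \<open>i > k\<close>.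
  Going down preserves them by a check at two positions. Going up is the obstacle: a raising
  transposition may leave the band, so it has to be chosen by comparing \<open>u\<close> with
  \<open>w\<close>. The maximality of \<open>w\<close> among the minimal coset representatives then
  comes cheaply, because values increasing on each side of the cut at \<open>k\<close> already force
  the band condition. The last two formulas are algebra: expanding \<open>(i + 1) ^ (n - k)\<close>
  in the binomial coefficients of \<open>i\<close> turns the alternating sum into the rook count,
  and the coefficients of the powers of \<open>1 - exp (-x)\<close> are signed Stirling numbers up
  to factorials.\<close>

text \<open>Count maps from \<open>m\<close> points to \<open>i + 1\<close> values by their fibres:
  an extra point joins the fibre of one fixed value, so that this fibre is never empty, and the
  other \<open>j\<close> nonempty fibres receive distinct values among the remaining
  \<open>i\<close>.\<close>

lemma power_Suc_eq_sum_Stirling: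
  "(i + 1) ^ m = (\<Sum>j\<le>m. Stirling (m + 1) (j + 1) * fact j * (i choose j))"
proof (induction m)
  case (Suc m)
  have split: "Stirling (m + 2) (j + 1) * fact j * (i choose j) =
      (j + 1) * Stirling (m + 1) (j + 1) * fact j * (i choose j) + Stirling (m + 1) j * fact j * (i choose j)" for j
    by (simp add: algebra_simps)
  have "(\<Sum>j\<le>Suc m. Stirling (m + 2) (j + 1) * fact j * (i choose j)) =
      (\<Sum>j\<le>Suc m. (j + 1) * Stirling (m + 1) (j + 1) * fact j * (i choose j)) +
      (\<Sum>j\<le>Suc m. Stirling (m + 1) j * fact j * (i choose j))"
    by (simp only: split sum.distrib)
  also have "(\<Sum>j\<le>Suc m. (j + 1) * Stirling (m + 1) (j + 1) * fact j * (i choose j)) =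
      (\<Sum>j\<le>m. (j + 1) * Stirling (m + 1) (j + 1) * fact j * (i choose j))"
    by simp
  also have "(\<Sum>j\<le>Suc m. Stirling (m + 1) j * fact j * (i choose j)) =
      (\<Sum>j\<le>m. Stirling (m + 1) (j + 1) * fact (j + 1) * (i choose (j + 1)))"
    by (subst sum.atMost_Suc_shift) simp
  also have "(\<Sum>j\<le>m. (j + 1) * Stirling (m + 1) (j + 1) * fact j * (i choose j)) + \<dots> =
      (\<Sum>j\<le>m. Stirling (m + 1) (j + 1) * fact j * ((j + 1) * ((i + 1) choose (j + 1))))"
    unfolding sum.distrib[symmetric] by (rule sum.cong) (simp_all add: algebra_simps)
  also have "\<dots> = (\<Sum>j\<le>m. (i + 1) * (Stirling (m + 1) (j + 1) * fact j * (i choose j)))"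
  proof (rule sum.cong)
    fix j
    have "(j + 1) * ((i + 1) choose (j + 1)) = (i + 1) * (i choose j)"
      using Suc_times_binomial_eq[of i j] by (simp add: algebra_simps)
    then show "Stirling (m + 1) (j + 1) * fact j * ((j + 1) * ((i + 1) choose (j + 1))) =
        (i + 1) * (Stirling (m + 1) (j + 1) * fact j * (i choose j))"
      by (simp only: mult_ac)
  qed simp
  also have "\<dots> = (i + 1) * (i + 1) ^ m"
    by (simp only: Suc.IH sum_distrib_left)
  finally show ?case by simp
qed simp

text \<open>In exponential generating functions over \<open>k\<close>, with
  \<open>z = 1 - exp (-x)\<close>, the left side is the sum of \<open>(i choose j) * z ^ i\<close>,
  that is \<open>exp x * (exp x - 1) ^ j\<close>, the derivative of
  \<open>(exp x - 1) ^ (j + 1) / (j + 1)\<close>. The index \<open>j\<close> stays arbitrary since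
  the induction step for \<open>j\<close> also draws on \<open>j - 1\<close>.\<close>

lemma alternating_sum_Stirling_binomial:
  "(\<Sum>i\<le>k. (-1) ^ (k + i) * fact i * int (Stirling k i) * int (i choose j)) =
     fact j * int (Stirling (k + 1) (j + 1))"
proof (induction k arbitrary: j)
  case 0
  show ?case by (cases j) simp_all
next
  case (Suc k)
  let ?A = "\<lambda>j. \<Sum>i\<le>k. (-1) ^ (k + i) * fact i * int (Stirling k i) * int (i choose j)"
  have split: "(-1) ^ (Suc k + i) * fact i * int (Stirling (Suc k) i) * int (i choose j) =
      - ((-1) ^ (k + i) * int i * fact i * int (Stirling k i) * int (i choose j)) +
      (if i = 0 then 0 else (-1) ^ (k + (i - 1)) * fact i * int (Stirling k (i - 1)) * int (i choose j))" for i
    by (cases i) (simp_all add: algebra_simps)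
  have "(\<Sum>i\<le>Suc k. (-1) ^ (Suc k + i) * fact i * int (Stirling (Suc k) i) * int (i choose j)) =
      (\<Sum>i\<le>Suc k. - ((-1) ^ (k + i) * int i * fact i * int (Stirling k i) * int (i choose j))) +
      (\<Sum>i\<le>Suc k. (if i = 0 then 0 else (-1) ^ (k + (i - 1)) * fact i * int (Stirling k (i - 1)) * int (i choose j)))"
    by (simp only: split sum.distrib)
  also have "(\<Sum>i\<le>Suc k. - ((-1) ^ (k + i) * int i * fact i * int (Stirling k i) * int (i choose j))) =
      (\<Sum>i\<le>k. - ((-1) ^ (k + i) * int i * fact i * int (Stirling k i) * int (i choose j)))"
    by simp
  also have "(\<Sum>i\<le>Suc k. (if i = 0 then 0 else (-1) ^ (k + (i - 1)) * fact i * int (Stirling k (i - 1)) * int (i choose j))) =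
      (\<Sum>i\<le>k. (-1) ^ (k + i) * fact (Suc i) * int (Stirling k i) * int (Suc i choose j))"
    by (subst sum.atMost_Suc_shift) simp
  also have "(\<Sum>i\<le>k. - ((-1) ^ (k + i) * int i * fact i * int (Stirling k i) * int (i choose j))) + \<dots> =
      (\<Sum>i\<le>k. (-1) ^ (k + i) * fact i * int (Stirling k i) * ((int i + 1) * int (Suc i choose j) - int i * int (i choose j)))"
    unfolding sum.distrib[symmetric] by (rule sum.cong) (simp_all add: algebra_simps)
  finally have step: "(\<Sum>i\<le>Suc k. (-1) ^ (Suc k + i) * fact i * int (Stirling (Suc k) i) * int (i choose j)) = \<dots>" .
  show ?case
  proof (cases j)
    case 0
    then show ?thesis using step Suc.IH[of 0] by (simp add: algebra_simps)
  next
    case (Suc l)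
    \<comment> \<open>Trades coefficients depending on \<open>i\<close> for ones depending only on
      \<open>l\<close>, so that both resulting sums are instances of the induction
      hypothesis.\<close>
    have binom: "(int i + 1) * int (Suc i choose Suc l) - int i * int (i choose Suc l) =
        (int l + 2) * int (i choose Suc l) + (int l + 1) * int (i choose l)" for i
    proof -
      have "int (Suc i * (i choose l)) = int ((Suc i choose Suc l) * Suc l)"
        by (simp only: Suc_times_binomial_eq)
      then show ?thesis by (simp add: algebra_simps)
    qed
    have "(\<Sum>i\<le>Suc k. (-1) ^ (Suc k + i) * fact i * int (Stirling (Suc k) i) * int (i choose j)) =
        (\<Sum>i\<le>k. (int l + 2) * ((-1) ^ (k + i) * fact i * int (Stirling k i) * int (i choose Suc l)) +
           (int l + 1) * ((-1) ^ (k + i) * fact i * int (Stirling k i) * int (i choose l)))"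
      unfolding step unfolding Suc binom by (rule sum.cong) (simp_all only: algebra_simps)
    also have "\<dots> = (int l + 2) * ?A (Suc l) + (int l + 1) * ?A l"
      by (simp only: sum.distrib sum_distrib_left)
    also have "\<dots> = fact j * int (Stirling (Suc k + 1) (j + 1))"
      unfolding Suc.IH Suc by (simp add: algebra_simps)
    finally show ?thesis .
  qed
qed

lemma Stirling_sum_eq_alternating_sum:
  "int (\<Sum>i = 0..k. Stirling (k + 1) (i + 1) * Stirling (m + 1) (i + 1) * (fact i)\<^sup>2) =
     (-1) ^ k * (\<Sum>i = 0..k. (-1) ^ i * (int i + 1) ^ m * fact i * int (Stirling k i))"
proof -
  let ?g = "\<lambda>j. int (Stirling (m + 1) (j + 1)) * fact j"
  have pow: "(int i + 1) ^ m = (\<Sum>j\<le>m. ?g j * int (i choose j))" for i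
    using arg_cong[OF power_Suc_eq_sum_Stirling[of i m], of int] by (simp add: add.commute)
  have "(-1) ^ k * (\<Sum>i = 0..k. (-1) ^ i * (int i + 1) ^ m * fact i * int (Stirling k i)) =
      (\<Sum>i\<le>k. \<Sum>j\<le>m. ?g j * ((-1) ^ (k + i) * fact i * int (Stirling k i) * int (i choose j)))"
    unfolding pow atMost_atLeast0
    by (simp add: sum_distrib_left sum_distrib_right power_add mult_ac)
  also have "\<dots> = (\<Sum>j\<le>m. ?g j * (fact j * int (Stirling (k + 1) (j + 1))))"
    by (subst sum.swap) (simp only: sum_distrib_left[symmetric] alternating_sum_Stirling_binomial)
  \<comment> \<open>One of the two Stirling numbers vanishes for \<open>j > m\<close> and the other
    for \<open>j > k\<close>, so the range \<open>j \<le> m\<close> can be exchanged for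
    \<open>j \<le> k\<close>.\<close>
  also have "\<dots> = (\<Sum>j\<le>max k m. ?g j * (fact j * int (Stirling (k + 1) (j + 1))))"
    by (rule sum.mono_neutral_left) auto
  also have "\<dots> = (\<Sum>j\<le>k. ?g j * (fact j * int (Stirling (k + 1) (j + 1))))"
    by (rule sum.mono_neutral_right) auto
  finally show ?thesis
    by (simp add: atMost_atLeast0 power2_eq_square mult_ac)
qed

section \<open>Poly-Bernoulli numbers of negative index\<close>

text \<open>The series \<open>g = 1 - exp (-x)\<close> has derivative \<open>1 - g\<close>, hence
  \<open>g ^ r\<close> has derivative \<open>r * (g ^ (r - 1) - g ^ r)\<close>. Coefficientwise this
  is the Stirling recurrence with alternating signs.\<close>

lemma fact_mult_fps_nth_power_one_minus_exp:
  "fact k * fps_nth ((1 - fps_exp (-1)) ^ r) k = ((-1) ^ (k + r) * fact r * of_nat (Stirling k r) :: rat)"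
proof (induction k arbitrary: r)
  case 0
  show ?case by (cases r) simp_all
next
  case (Suc k)
  let ?g = "1 - fps_exp (-1) :: rat fps"
  show ?case
  proof (cases r)
    case (Suc s)
    have "fps_deriv ?g = 1 - ?g"
      by (simp flip: fps_const_neg)
    then have "fps_deriv (?g ^ Suc s) = fps_const (of_nat (Suc s)) * (1 - ?g) * ?g ^ s"
      by (simp only: fps_deriv_power) simp
    also have "\<dots> = fps_const (of_nat (Suc s)) * (?g ^ s - ?g ^ Suc s)"
      by (simp only: power_Suc ring_distribs mult_1_left mult_1_right mult.assoc)
    finally have "fps_nth (fps_deriv (?g ^ Suc s)) k =
        of_nat (Suc s) * (fps_nth (?g ^ s) k - fps_nth (?g ^ Suc s) k)"
      by (simp only: fps_mult_left_const_nth fps_sub_nth)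
    then have "fact (Suc k) * fps_nth (?g ^ Suc s) (Suc k) =
        of_nat (Suc s) * (fact k * fps_nth (?g ^ s) k - fact k * fps_nth (?g ^ Suc s) k)"
      unfolding fps_deriv_nth fact_Suc by (simp only: Suc_eq_plus1 right_diff_distrib' mult_ac)
    also have "\<dots> = (-1) ^ (Suc k + Suc s) * fact (Suc s) * of_nat (Stirling (Suc k) (Suc s))"
      unfolding Suc.IH by (simp add: algebra_simps)
    finally show ?thesis using Suc by simp
  qed simp
qed

text \<open>For index \<open>-m\<close> the polylogarithm has coefficients \<open>r ^ m\<close> for
  \<open>r \<ge> 1\<close>, so it is \<open>fps_X\<close> times a series \<open>G\<close> and the
  divisor cancels. Since \<open>1 - exp (-x)\<close> has no constant term, only its powers up to
  \<open>k\<close> reach the coefficient of \<open>x ^ k\<close>.\<close>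

lemma poly_bernoulli_neg_eq:
  "poly_bernoulli (- int m) k =
     of_int ((-1) ^ k * (\<Sum>i = 0..k. (-1) ^ i * (int i + 1) ^ m * fact i * int (Stirling k i)))"
proof -
  let ?g = "1 - fps_exp (-1) :: rat fps"
  define G :: "rat fps" where "G = Abs_fps (\<lambda>r. (of_nat r + 1) ^ m)"
  have Li: "fps_Li (- int m) = fps_X * G"
    by (rule fps_ext) (auto simp: fps_Li_def G_def power_int_minus divide_simps)
  have "?g \<noteq> 0"
  proof
    assume "?g = 0"
    then have "fps_nth ?g 1 = 0" by simp
    then show False by simp
  qed
  moreover have "fps_Li (- int m) oo ?g = ?g * (G oo ?g)"
    unfolding Li by (subst fps_compose_mult_distrib) simp_all
  ultimately have "(fps_Li (- int m) oo ?g) / ?g = G oo ?g" by simp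
  then have "poly_bernoulli (- int m) k = (\<Sum>i = 0..k. (of_nat i + 1) ^ m * (fact k * fps_nth (?g ^ i) k))"
    by (simp add: poly_bernoulli_def fps_compose_nth G_def sum_distrib_left mult_ac)
  then show ?thesis
    unfolding fact_mult_fps_nth_power_one_minus_exp
    by (simp add: sum_distrib_left power_add mult_ac)
qed

subsection \<open>Rook placements\<close>

text \<open>Placements are sets of (row, column) pairs rather than functions: cutting into blocks
  becomes intersection with rectangles, gluing becomes union, transposing becomes
  \<open>converse\<close>.\<close>

definition nonattacking :: "('a \<times> 'b) set \<Rightarrow> bool" where
  "nonattacking M \<longleftrightarrow> inj_on fst M \<and> inj_on snd M"

definition rook_placements :: "('a \<times> 'b) set \<Rightarrow> ('a \<times> 'b) set set" where
  "rook_placements X = {M. M \<subseteq> X \<and> nonattacking M}"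

definition perfect_matchings :: "'a set \<Rightarrow> 'b set \<Rightarrow> ('a \<times> 'b) set set" where
  "perfect_matchings A B = {M. nonattacking M \<and> fst ` M = A \<and> snd ` M = B}"

lemma nonattacking_altdef:
  "nonattacking M \<longleftrightarrow>
     (\<forall>a b c. (a, b) \<in> M \<longrightarrow> (a, c) \<in> M \<longrightarrow> b = c) \<and> (\<forall>a b c. (a, c) \<in> M \<longrightarrow> (b, c) \<in> M \<longrightarrow> a = b)"
  unfolding nonattacking_def inj_on_def Ball_def split_paired_All fst_conv snd_conv prod.inject by blast

lemma finite_rook_placements: "finite X \<Longrightarrow> finite (rook_placements X)"
  by (rule finite_subset[of _ "Pow X"]) (auto simp: rook_placements_def)

text \<open>Serves twice: an arbitrary \<open>h\<close> reduces the count of perfect matchings to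
  that of permutations, and \<open>h = id\<close> identifies permutations with their
  matrices.\<close>

lemma bij_betw_graph_perfect_matchings:
  assumes h: "bij_betw h A B"
  shows "bij_betw (\<lambda>p. (\<lambda>a. (a, h (p a))) ` A) {p. p permutes A} (perfect_matchings A B)"
proof (rule bij_betw_imageI)
  show "inj_on (\<lambda>p. (\<lambda>a. (a, h (p a))) ` A) {p. p permutes A}"
  proof (rule inj_onI, clarsimp)
    fix p q assume p: "p permutes A" and q: "q permutes A"
      and eq: "(\<lambda>a. (a, h (p a))) ` A = (\<lambda>a. (a, h (q a))) ` A"
    show "p = q"
    proof
      fix a
      show "p a = q a"
      proof (cases "a \<in> A")
        case True
        then have "(a, h (p a)) \<in> (\<lambda>a. (a, h (q a))) ` A" using eq by blast
        then have "h (p a) = h (q a)" by blast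
        then show ?thesis
          using True p q h by (meson bij_betw_def inj_onD permutes_in_image)
      next
        case False
        then show ?thesis using p q by (simp add: permutes_not_in)
      qed
    qed
  qed
next
  show "(\<lambda>p. (\<lambda>a. (a, h (p a))) ` A) ` {p. p permutes A} = perfect_matchings A B" (is "?L = _")
  proof
    show "?L \<subseteq> perfect_matchings A B"
    proof clarify
      fix p assume p: "p permutes A"
      have "bij_betw (\<lambda>a. h (p a)) A B"
        using bij_betw_trans[OF permutes_imp_bij[OF p] h] by (simp add: o_def)
      then show "(\<lambda>a. (a, h (p a))) ` A \<in> perfect_matchings A B"
        by (auto simp: perfect_matchings_def nonattacking_def bij_betw_def inj_on_def image_image)
    qed
  next
    show "perfect_matchings A B \<subseteq> ?L"
    proof
      fix M assume M: "M \<in> perfect_matchings A B"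
      have "\<forall>a\<in>A. \<exists>b. (a, b) \<in> M" using M by (force simp: perfect_matchings_def)
      then obtain f where f: "\<And>a. a \<in> A \<Longrightarrow> (a, f a) \<in> M" by metis
      have Meq: "M = (\<lambda>a. (a, f a)) ` A"
      proof
        show "M \<subseteq> (\<lambda>a. (a, f a)) ` A"
        proof clarify
          fix a b assume ab: "(a, b) \<in> M"
          then have "a \<in> A" using M by (force simp: perfect_matchings_def)
          moreover have "b = f a"
            using M ab f[OF \<open>a \<in> A\<close>] by (auto simp: perfect_matchings_def nonattacking_altdef)
          ultimately show "(a, b) \<in> (\<lambda>a. (a, f a)) ` A" by blast
        qed
      qed (use f in blast)
      have "inj_on f A"
      proof (rule inj_onI)
        fix x y assume "x \<in> A" "y \<in> A" "f x = f y"
        then show "x = y"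
          using M f[of x] f[of y] by (auto simp: perfect_matchings_def nonattacking_altdef)
      qed
      moreover have "f ` A = B"
        using M by (simp add: perfect_matchings_def Meq image_image)
      ultimately have f_bij: "bij_betw f A B" by (simp add: bij_betw_def)
      \<comment> \<open>On \<open>A\<close> this is forced to be
        \<open>h\<inverse> \<circ> f\<close>; outside, \<open>permutes\<close> demands the
        identity.\<close>
      define p where "p = (\<lambda>a. if a \<in> A then inv_into A h (f a) else a)"
      have "bij_betw (\<lambda>a. inv_into A h (f a)) A A"
        using bij_betw_trans[OF f_bij bij_betw_inv_into[OF h]] by (simp add: o_def)
      then have "bij_betw p A A"
        by (subst bij_betw_cong[where g = "\<lambda>a. inv_into A h (f a)"]) (simp_all add: p_def)
      then have "p permutes A" by (intro bij_imp_permutes) (simp_all add: p_def)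
      moreover have "M = (\<lambda>a. (a, h (p a))) ` A"
        unfolding Meq
      proof (rule image_cong)
        fix a assume "a \<in> A"
        then show "(a, f a) = (a, h (p a))"
          using h f_bij by (simp add: p_def bij_betw_inv_into_right bij_betw_apply)
      qed simp
      ultimately show "M \<in> ?L" by blast
    qed
  qed
qed

lemma card_perfect_matchings:
  assumes "finite A" "finite B"
  shows "card (perfect_matchings A B) = (if card A = card B then fact (card A) else 0)"
proof (cases "card A = card B")
  case True
  then obtain h where "bij_betw h A B" using assms finite_same_card_bij by blast
  from bij_betw_same_card[OF bij_betw_graph_perfect_matchings[OF this]] show ?thesis
    using True card_permutations[OF refl assms(1)] by simp
next
  case False
  have "card A = card B" if "M \<in> perfect_matchings A B" for M
    using that card_image[of fst M] card_image[of snd M]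
    by (auto simp: perfect_matchings_def nonattacking_def)
  then have "perfect_matchings A B = {}" using False by blast
  then show ?thesis using False by simp
qed

lemma finite_perfect_matchings:
  assumes "finite A" "finite B"
  shows "finite (perfect_matchings A B)"
proof (rule finite_subset)
  show "perfect_matchings A B \<subseteq> Pow (A \<times> B)"
    by (force simp: perfect_matchings_def)
qed (use assms in simp)

section \<open>Cutting a matching into four blocks\<close>

text \<open>Rows split into top \<open>T\<close> and bottom \<open>B\<close>, columns into left
  \<open>L\<close> and right \<open>R\<close>. The rooks \<open>M1\<close>, \<open>M2\<close> in the
  restricted blocks are placed independently; what they leave over dictates which rows and columns
  \<open>M3\<close> in \<open>T \<times> L\<close> and \<open>M4\<close> in
  \<open>B \<times> R\<close> have to exhaust.\<close>

lemma bij_betw_block_decomposition: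
  assumes disj: "T \<inter> B = {}" "L \<inter> R = {}" and X: "X \<subseteq> T \<times> R" and Y: "Y \<subseteq> B \<times> L"
  shows "bij_betw (\<lambda>(M1, M2, M3, M4). M1 \<union> M2 \<union> M3 \<union> M4)
    (SIGMA M1:rook_placements X. SIGMA M2:rook_placements Y.
       perfect_matchings (T - fst ` M1) (L - snd ` M2) \<times> perfect_matchings (B - fst ` M2) (R - snd ` M1))
    {M \<in> perfect_matchings (T \<union> B) (L \<union> R). M \<inter> T \<times> R \<subseteq> X \<and> M \<inter> B \<times> L \<subseteq> Y}"
    (is "bij_betw ?f ?D ?E")
proof (rule bij_betw_byWitness[where f' = "\<lambda>M. (M \<inter> T \<times> R, M \<inter> B \<times> L, M \<inter> T \<times> L, M \<inter> B \<times> R)"])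
  let ?g = "\<lambda>M. (M \<inter> T \<times> R, M \<inter> B \<times> L, M \<inter> T \<times> L, M \<inter> B \<times> R)"
  have D: "M1 \<subseteq> T \<times> R" "M2 \<subseteq> B \<times> L" "M3 \<subseteq> T \<times> L" "M4 \<subseteq> B \<times> R"
    if "(M1, M2, M3, M4) \<in> ?D" for M1 M2 M3 M4
  proof -
    show "M1 \<subseteq> T \<times> R" "M2 \<subseteq> B \<times> L"
      using that X Y by (auto simp: rook_placements_def)
    have "fst ` M3 \<subseteq> T" "snd ` M3 \<subseteq> L" "fst ` M4 \<subseteq> B" "snd ` M4 \<subseteq> R"
      using that by (auto simp: perfect_matchings_def)
    then show "M3 \<subseteq> T \<times> L" "M4 \<subseteq> B \<times> R"
      by (auto intro!: subset_trans[OF subset_fst_snd Sigma_mono])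
  qed
  have off_block: "M \<inter> U \<times> V = {}" if "M \<subseteq> U' \<times> V'" "U \<inter> U' = {} \<or> V \<inter> V' = {}"
    for M :: "('a \<times> 'b) set" and U V U' V'
    using that by fast
  have blocks: "(M1 \<union> M2 \<union> M3 \<union> M4) \<inter> T \<times> R = M1" "(M1 \<union> M2 \<union> M3 \<union> M4) \<inter> B \<times> L = M2"
    "(M1 \<union> M2 \<union> M3 \<union> M4) \<inter> T \<times> L = M3" "(M1 \<union> M2 \<union> M3 \<union> M4) \<inter> B \<times> R = M4"
    if "(M1, M2, M3, M4) \<in> ?D" for M1 M2 M3 M4
  proof -
    note D = D[OF that]
    note off = off_block[OF D(1)] off_block[OF D(2)] off_block[OF D(3)] off_block[OF D(4)]
    have disj': "B \<inter> T = {}" "R \<inter> L = {}" using disj by auto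
    show "(M1 \<union> M2 \<union> M3 \<union> M4) \<inter> T \<times> R = M1" "(M1 \<union> M2 \<union> M3 \<union> M4) \<inter> B \<times> L = M2"
      "(M1 \<union> M2 \<union> M3 \<union> M4) \<inter> T \<times> L = M3" "(M1 \<union> M2 \<union> M3 \<union> M4) \<inter> B \<times> R = M4"
      by (simp_all only: Int_Un_distrib2 off disj disj' Int_absorb2[OF D(1)] Int_absorb2[OF D(2)]
            Int_absorb2[OF D(3)] Int_absorb2[OF D(4)] Un_empty_left Un_empty_right simp_thms)
  qed
  then have "?g (?f d) = d" if "d \<in> ?D" for d
    using that by (cases d) (simp only: prod.case)
  then show "\<forall>d\<in>?D. ?g (?f d) = d" by (rule ballI)
  show "\<forall>M\<in>?E. ?f (?g M) = M"
  proof
    fix M assume "M \<in> ?E"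
    then have "M \<subseteq> (T \<union> B) \<times> (L \<union> R)"
      using subset_fst_snd[of M] by (simp add: perfect_matchings_def)
    then show "?f (?g M) = M" by auto
  qed
  have "?f (M1, M2, M3, M4) \<in> ?E" if d: "(M1, M2, M3, M4) \<in> ?D" for M1 M2 M3 M4
  proof -
    note D = D[OF d]
    have na: "nonattacking M1" "nonattacking M2" "nonattacking M3" "nonattacking M4"
      using d by (auto simp: rook_placements_def perfect_matchings_def)
    have im: "fst ` M3 = T - fst ` M1" "snd ` M3 = L - snd ` M2"
      "fst ` M4 = B - fst ` M2" "snd ` M4 = R - snd ` M1"
      using d by (auto simp: perfect_matchings_def)
    have sub: "M1 \<subseteq> X" "M2 \<subseteq> Y" using d by (auto simp: rook_placements_def)
    have fst_in: "fst ` M1 \<subseteq> T" "fst ` M2 \<subseteq> B" "snd ` M1 \<subseteq> R" "snd ` M2 \<subseteq> L" using D by auto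
    have inj_Un: "inj_on f (U \<union> V)" if "inj_on f U" "inj_on f V" "f ` U \<inter> f ` V = {}"
      for f :: "'c \<Rightarrow> 'd" and U V
      using that unfolding inj_on_Un by blast
    \<comment> \<open>\<open>P\<close> and \<open>Q\<close> are the rows, or the columns, used by
      \<open>M1\<close> and \<open>M2\<close>. Both orders of the differences occur because
      \<open>M3\<close> completes the rows of \<open>M1\<close> but the columns of
      \<open>M2\<close>, and \<open>M4\<close> the opposite.\<close>
    have sep: "P \<inter> Q = {}" "(P \<union> Q) \<inter> (U - P) = {}" "(P \<union> Q) \<inter> (V - Q) = {}"
      "(P \<union> Q \<union> (U - P)) \<inter> (V - Q) = {}" "(P \<union> Q \<union> (V - Q)) \<inter> (U - P) = {}"
      "P \<union> Q \<union> (U - P) \<union> (V - Q) = U \<union> V" "P \<union> Q \<union> (V - Q) \<union> (U - P) = V \<union> U"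
      if "P \<subseteq> U" "Q \<subseteq> V" "U \<inter> V = {}" for P Q U V :: "'c set"
      using that by blast+
    have "inj_on fst (M1 \<union> M2 \<union> M3 \<union> M4)"
      using na sep[OF fst_in(1,2) disj(1)] unfolding nonattacking_def
      by (intro inj_Un) (simp_all only: image_Un im)
    moreover have RL: "R \<inter> L = {}" using disj by auto
    then have "inj_on snd (M1 \<union> M2 \<union> M3 \<union> M4)"
      using na sep[OF fst_in(3,4)] unfolding nonattacking_def
      by (intro inj_Un) (simp_all only: image_Un im)
    moreover have "fst ` (M1 \<union> M2 \<union> M3 \<union> M4) = T \<union> B"
      using sep(6)[OF fst_in(1,2) disj(1)] by (simp only: image_Un im)
    moreover have "snd ` (M1 \<union> M2 \<union> M3 \<union> M4) = L \<union> R"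
      using sep(7)[OF fst_in(3,4) RL] by (simp only: image_Un im)
    ultimately have "M1 \<union> M2 \<union> M3 \<union> M4 \<in> perfect_matchings (T \<union> B) (L \<union> R)"
      by (simp only: perfect_matchings_def nonattacking_def mem_Collect_eq simp_thms)
    moreover have "(M1 \<union> M2 \<union> M3 \<union> M4) \<inter> T \<times> R \<subseteq> X" "(M1 \<union> M2 \<union> M3 \<union> M4) \<inter> B \<times> L \<subseteq> Y"
      unfolding blocks[OF d] by (fact sub)+
    ultimately show ?thesis by simp
  qed
  then show "?f ` ?D \<subseteq> ?E" by (intro image_subsetI) (simp only: split_paired_all)
  show "?g ` ?E \<subseteq> ?D"
  proof (rule image_subsetI)
    fix M assume M: "M \<in> ?E"
    then have na: "nonattacking M" and fs: "fst ` M = T \<union> B" "snd ` M = L \<union> R"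
      by (auto simp: perfect_matchings_def)
    have M_sub: "M \<subseteq> (T \<union> B) \<times> (L \<union> R)" using subset_fst_snd[of M] fs by simp
    have na_sub: "nonattacking (M \<inter> Z)" for Z
      using na by (auto simp: nonattacking_def intro: inj_on_subset)
    have row: "\<exists>c. (r, c) \<in> M" if "r \<in> T \<union> B" for r
      using that unfolding fs(1)[symmetric] by force
    have col: "\<exists>r. (r, c) \<in> M" if "c \<in> L \<union> R" for c
      using that unfolding fs(2)[symmetric] by force
    have uniq: "b = c" if "(a, b) \<in> M" "(a, c) \<in> M" for a b c
      using na that by (auto simp: nonattacking_altdef)
    have uniq': "a = b" if "(a, c) \<in> M" "(b, c) \<in> M" for a b c
      using na that by (auto simp: nonattacking_altdef)
    have rows: "fst ` (M \<inter> U \<times> V) = U - fst ` (M \<inter> U \<times> W)"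
      if UV: "U \<subseteq> T \<union> B" "V \<union> W = L \<union> R" "V \<inter> W = {}" for U V W
    proof (intro equalityI subsetI)
      fix r assume "r \<in> fst ` (M \<inter> U \<times> V)"
      then obtain c where "(r, c) \<in> M" "r \<in> U" "c \<in> V" by auto
      moreover have "d \<notin> W" if "(r, d) \<in> M" for d
        using uniq[OF that \<open>(r, c) \<in> M\<close>] \<open>c \<in> V\<close> \<open>V \<inter> W = {}\<close> by blast
      ultimately show "r \<in> U - fst ` (M \<inter> U \<times> W)" by auto
    next
      fix r assume r: "r \<in> U - fst ` (M \<inter> U \<times> W)"
      then obtain c where c: "(r, c) \<in> M" using row UV by blast
      then have "c \<in> V \<union> W" using M_sub UV by blast
      moreover have "r \<in> fst ` (M \<inter> U \<times> W)" if "c \<in> W"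
        using that r c by (intro image_eqI[of _ _ "(r, c)"]) auto
      ultimately have "c \<in> V" using r by blast
      then show "r \<in> fst ` (M \<inter> U \<times> V)" using r c by force
    qed
    have cols: "snd ` (M \<inter> U \<times> V) = V - snd ` (M \<inter> W \<times> V)"
      if UV: "V \<subseteq> L \<union> R" "U \<union> W = T \<union> B" "U \<inter> W = {}" for U V W
    proof (intro equalityI subsetI)
      fix c assume "c \<in> snd ` (M \<inter> U \<times> V)"
      then obtain r where "(r, c) \<in> M" "r \<in> U" "c \<in> V" by auto
      moreover have "d \<notin> W" if "(d, c) \<in> M" for d
        using uniq'[OF that \<open>(r, c) \<in> M\<close>] \<open>r \<in> U\<close> \<open>U \<inter> W = {}\<close> by blast
      ultimately show "c \<in> V - snd ` (M \<inter> W \<times> V)" by auto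
    next
      fix c assume c: "c \<in> V - snd ` (M \<inter> W \<times> V)"
      then obtain r where r: "(r, c) \<in> M" using col UV by blast
      then have "r \<in> U \<union> W" using M_sub UV by blast
      moreover have "c \<in> snd ` (M \<inter> W \<times> V)" if "r \<in> W"
        using that r c by (intro image_eqI[of _ _ "(r, c)"]) auto
      ultimately have "r \<in> U" using c by blast
      then show "c \<in> snd ` (M \<inter> U \<times> V)" using r c by force
    qed
    have "M \<inter> T \<times> R \<in> rook_placements X" "M \<inter> B \<times> L \<in> rook_placements Y"
      using M na_sub by (auto simp: rook_placements_def)
    moreover have "M \<inter> T \<times> L \<in> perfect_matchings (T - fst ` (M \<inter> T \<times> R)) (L - snd ` (M \<inter> B \<times> L))"
      using rows[of T L R] cols[of L T B] na_sub disj by (simp add: perfect_matchings_def Un_commute)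
    moreover have "M \<inter> B \<times> R \<in> perfect_matchings (B - fst ` (M \<inter> B \<times> L)) (R - snd ` (M \<inter> T \<times> R))"
      using rows[of B R L] cols[of R B T] na_sub disj
      by (simp add: perfect_matchings_def Un_commute Int_commute[of B] Int_commute[of R])
    ultimately show "?g M \<in> ?D" by (intro SigmaI)
  qed
qed

text \<open>\<open>M3\<close> and \<open>M4\<close> can exist only if
  \<open>k - card M1 = m - card M2\<close>; the common value \<open>i\<close> is then the size of
  both, which leaves \<open>fact i\<close> choices for each.\<close>

lemma card_block_matchings:
  assumes disj: "T \<inter> B = {}" "L \<inter> R = {}" and X: "X \<subseteq> T \<times> R" and Y: "Y \<subseteq> B \<times> L"
    and fin: "finite T" "finite B" "finite L" "finite R"
    and card: "card T = k" "card R = k" "card B = m" "card L = m"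
  shows "card {M \<in> perfect_matchings (T \<union> B) (L \<union> R). M \<inter> T \<times> R \<subseteq> X \<and> M \<inter> B \<times> L \<subseteq> Y} =
    (\<Sum>i = 0..k. card {M \<in> rook_placements X. card M + i = k} *
       card {M \<in> rook_placements Y. card M + i = m} * (fact i)\<^sup>2)"
proof -
  have finX: "finite X" and finY: "finite Y"
    using X Y fin by (meson finite_SigmaI finite_subset)+
  have rX: "card (T - fst ` M) = k - card M" "card (R - snd ` M) = k - card M" "card M \<le> k"
    if "M \<in> rook_placements X" for M
  proof -
    have M: "fst ` M \<subseteq> T" "snd ` M \<subseteq> R" "card (fst ` M) = card M" "card (snd ` M) = card M"
      using that X by (auto simp: rook_placements_def nonattacking_def card_image)
    then show "card (T - fst ` M) = k - card M" "card (R - snd ` M) = k - card M" "card M \<le> k"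
      using fin card card_mono[OF fin(1) M(1)]
      by (simp_all add: card_Diff_subset finite_subset[OF M(1)] finite_subset[OF M(2)])
  qed
  have rY: "card (B - fst ` M) = m - card M" "card (L - snd ` M) = m - card M" "card M \<le> m"
    if "M \<in> rook_placements Y" for M
  proof -
    have M: "fst ` M \<subseteq> B" "snd ` M \<subseteq> L" "card (fst ` M) = card M" "card (snd ` M) = card M"
      using that Y by (auto simp: rook_placements_def nonattacking_def card_image)
    then show "card (B - fst ` M) = m - card M" "card (L - snd ` M) = m - card M" "card M \<le> m"
      using fin card card_mono[OF fin(2) M(1)]
      by (simp_all add: card_Diff_subset finite_subset[OF M(1)] finite_subset[OF M(2)])
  qed
  let ?P = "\<lambda>M1 M2. perfect_matchings (T - fst ` M1) (L - snd ` M2) \<times>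
    perfect_matchings (B - fst ` M2) (R - snd ` M1)"
  \<comment> \<open>At most one \<open>i\<close> contributes, namely \<open>k - card M1\<close>.
    Separate indicators for \<open>M1\<close> and \<open>M2\<close> let the double sum over the
    placements factor for each \<open>i\<close>.\<close>
  have P: "card (?P M1 M2) =
      (\<Sum>i = 0..k. (if card M1 + i = k then 1 else 0) * (if card M2 + i = m then 1 else 0) * (fact i)\<^sup>2)"
    if "M1 \<in> rook_placements X" "M2 \<in> rook_placements Y" for M1 M2
  proof -
    have "(\<Sum>i = 0..k. (if card M1 + i = k then 1 else 0) * (if card M2 + i = m then 1 else 0) * (fact i)\<^sup>2) =
        (\<Sum>i = 0..k. if i = k - card M1 then (if card M2 + i = m then (fact i)\<^sup>2 else (0::nat)) else 0)"
      by (rule sum.cong) (use rX(3)[OF that(1)] in auto)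
    also have "\<dots> = (if card M2 + (k - card M1) = m then (fact (k - card M1))\<^sup>2 else 0)"
      by (subst sum.delta) auto
    also have "\<dots> = card (?P M1 M2)"
      using rX[OF that(1)] rY[OF that(2)] fin
      by (auto simp: card_cartesian_product card_perfect_matchings power2_eq_square)
    finally show ?thesis by simp
  qed
  have "card {M \<in> perfect_matchings (T \<union> B) (L \<union> R). M \<inter> T \<times> R \<subseteq> X \<and> M \<inter> B \<times> L \<subseteq> Y} =
      card (SIGMA M1:rook_placements X. SIGMA M2:rook_placements Y. ?P M1 M2)"
    using bij_betw_same_card[OF bij_betw_block_decomposition[OF disj X Y]] by simp
  also have "\<dots> = (\<Sum>M1\<in>rook_placements X. \<Sum>M2\<in>rook_placements Y. card (?P M1 M2))"
    using fin by (simp add: finite_rook_placements finX finY finite_perfect_matchings card_SigmaI finite_SigmaI)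
  also have "\<dots> = (\<Sum>M1\<in>rook_placements X. \<Sum>M2\<in>rook_placements Y.
      \<Sum>i = 0..k. (if card M1 + i = k then 1 else 0) * (if card M2 + i = m then 1 else 0) * (fact i)\<^sup>2)"
    by (intro sum.cong P) auto
  also have "\<dots> = (\<Sum>i = 0..k. \<Sum>M1\<in>rook_placements X. \<Sum>M2\<in>rook_placements Y.
      (if card M1 + i = k then 1 else 0) * (if card M2 + i = m then 1 else 0) * (fact i)\<^sup>2)"
    by (simp only: sum.swap[of _ _ "{0..k}"])
  also have "\<dots> = (\<Sum>i = 0..k. (\<Sum>M1\<in>rook_placements X. if card M1 + i = k then 1 else 0) *
      (\<Sum>M2\<in>rook_placements Y. if card M2 + i = m then 1 else 0) * (fact i)\<^sup>2)"
    by (simp only: sum_product) (simp only: sum_distrib_right)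
  finally show ?thesis
    by (simp add: finite_rook_placements finX finY sum.inter_filter[symmetric])
qed

section \<open>Staircase boards\<close>

text \<open>A staircase with \<open>i\<close> cells in row \<open>i\<close>, shifted by
  \<open>s\<close> columns. With \<open>m = n - k\<close>, the restricted blocks are
  \<open>triangle m k\<close> and the transpose of \<open>triangle k m\<close>.\<close>

definition triangle :: "nat \<Rightarrow> nat \<Rightarrow> (nat \<times> nat) set" where
  "triangle s k = {(i, c). 1 \<le> i \<and> i \<le> k \<and> s < c \<and> c \<le> s + i}"

lemma finite_triangle: "finite (triangle s k)"
  by (rule finite_subset[of _ "{..k} \<times> {..s + k}"]) (auto simp: triangle_def)

text \<open>Here \<open>i\<close> counts the empty rows. The last row spans all columns: if it is
  empty, the rest is a placement on the smaller staircase with one empty row fewer; if not, its rook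
  takes one of the \<open>i + 1\<close> columns left free by the others. This is the Stirling
  recurrence.\<close>

lemma card_rook_placements_triangle:
  "card {M \<in> rook_placements (triangle s k). card M + i = k} = Stirling (k + 1) (i + 1)"
proof (induction k arbitrary: i)
  case 0
  have "{M \<in> rook_placements (triangle s 0). card M + i = 0} = (if i = 0 then {{}} else {})"
    by (auto simp: triangle_def rook_placements_def nonattacking_def)
  then show ?case by (cases i) auto
next
  case (Suc k)
  let ?R = "\<lambda>k i. {M \<in> rook_placements (triangle s k). card M + i = k}"
  let ?C = "{s<..s + Suc k}"
  let ?D = "SIGMA M:?R k i. ?C - snd ` M"
  let ?f = "\<lambda>(M, c). insert (Suc k, c) M"
  have fin: "finite M" if "M \<in> rook_placements (triangle s l)" for M l
    using that finite_triangle by (auto simp: rook_placements_def intro: finite_subset)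
  have fin_R: "finite (?R l j)" for l j
    using finite_rook_placements[OF finite_triangle] by auto
  have tri_Suc: "triangle s (Suc k) = triangle s k \<union> {Suc k} \<times> ?C"
    by (auto simp: triangle_def)
  have new: "(Suc k, c) \<notin> M" if "M \<in> rook_placements (triangle s k)" for M c
    using that by (auto simp: rook_placements_def triangle_def)
  have split: "?R (Suc k) i = {M \<in> rook_placements (triangle s k). card M + i = Suc k} \<union> ?f ` ?D"
  proof (intro equalityI subsetI)
    fix M assume M: "M \<in> ?R (Suc k) i"
    show "M \<in> {M \<in> rook_placements (triangle s k). card M + i = Suc k} \<union> ?f ` ?D"
    proof (cases "\<exists>c. (Suc k, c) \<in> M")
      case False
      then show ?thesis using M by (auto simp: rook_placements_def tri_Suc)
    next
      case True
      then obtain c where c: "(Suc k, c) \<in> M" by blast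
      let ?N = "M - {(Suc k, c)}"
      have "?N \<subseteq> triangle s k"
        using M c by (auto simp: rook_placements_def tri_Suc nonattacking_altdef)
      moreover have "nonattacking ?N"
        using M by (auto simp: rook_placements_def nonattacking_def intro: inj_on_subset)
      moreover have "card M = Suc (card ?N)"
        using M c fin by (metis (no_types, lifting) card.remove mem_Collect_eq)
      ultimately have "?N \<in> ?R k i" using M by (simp add: rook_placements_def)
      moreover have "c \<in> ?C - snd ` ?N"
        using M c by (auto simp: rook_placements_def nonattacking_altdef triangle_def)
      ultimately have "(?N, c) \<in> ?D" by blast
      moreover have "M = ?f (?N, c)" using c by auto
      ultimately show ?thesis by blast
    qed
  next
    fix M assume "M \<in> {M \<in> rook_placements (triangle s k). card M + i = Suc k} \<union> ?f ` ?D"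
    then show "M \<in> ?R (Suc k) i"
    proof
      assume "M \<in> ?f ` ?D"
      then obtain N c where N: "N \<in> ?R k i" and c: "c \<in> ?C" "c \<notin> snd ` N" and M: "M = insert (Suc k, c) N"
        by auto
      have "Suc k \<notin> fst ` N" using N by (auto simp: rook_placements_def triangle_def)
      then have "nonattacking M"
        using N c by (auto simp: M rook_placements_def nonattacking_def)
      moreover have "M \<subseteq> triangle s (Suc k)"
        using N c by (auto simp: M rook_placements_def tri_Suc)
      moreover have "card M + i = Suc k"
        using N new[of N c] fin[of N k] by (auto simp: M)
      ultimately show ?thesis by (simp add: rook_placements_def)
    qed (auto simp: rook_placements_def tri_Suc)
  qed
  have inj: "inj_on ?f ?D"
  proof (rule inj_onI)
    fix x y assume "x \<in> ?D" "y \<in> ?D" and eq: "?f x = ?f y"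
    then obtain M c N d where xy: "x = (M, c)" "y = (N, d)"
      and M: "M \<in> rook_placements (triangle s k)" and N: "N \<in> rook_placements (triangle s k)"
      by auto
    from eq have eq: "insert (Suc k, c) M = insert (Suc k, d) N" by (simp add: xy)
    then have "c = d" using new[OF N, of c] by auto
    moreover from this have "M = N" using eq new[OF M] new[OF N] by (simp add: insert_ident)
    ultimately show "x = y" by (simp add: xy)
  qed
  have "card ?D = (\<Sum>M\<in>?R k i. card (?C - snd ` M))"
    by (intro card_SigmaI fin_R ballI) simp
  also have "\<dots> = (\<Sum>M\<in>?R k i. i + 1)"
  proof (rule sum.cong)
    fix M assume M: "M \<in> ?R k i"
    then have "snd ` M \<subseteq> ?C" by (force simp: rook_placements_def triangle_def)
    moreover have "card (snd ` M) = card M"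
      using M by (auto simp: rook_placements_def nonattacking_def card_image)
    ultimately show "card (?C - snd ` M) = i + 1"
      using M by (subst card_Diff_subset) (auto intro: finite_subset)
  qed simp
  also have "\<dots> = (i + 1) * Stirling (k + 1) (i + 1)" by (simp add: Suc.IH[simplified])
  finally have card_D: "card (?f ` ?D) = (i + 1) * Stirling (k + 1) (i + 1)"
    using card_image[OF inj] by simp
  have old: "card {M \<in> rook_placements (triangle s k). card M + i = Suc k} = Stirling (k + 1) i"
  proof (cases i)
    \<comment> \<open>This would take \<open>Suc k\<close> rooks in only \<open>k\<close> rows, in
      agreement with \<open>Stirling (k + 1) 0 = 0\<close>.\<close>
    case 0
    have "card M \<noteq> Suc k" if M: "M \<in> rook_placements (triangle s k)" for M
    proof -
      have "fst ` M \<subseteq> {1..k}" "card (fst ` M) = card M"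
        using M by (auto simp: rook_placements_def triangle_def nonattacking_def card_image)
      then show ?thesis using card_mono[of "{1..k}" "fst ` M"] by simp
    qed
    then have "{M \<in> rook_placements (triangle s k). card M + i = Suc k} = {}" using 0 by auto
    then show ?thesis using 0 by (simp only: card.empty) simp
  next
    case (Suc j)
    then show ?thesis using Suc.IH[of j] by simp
  qed
  have "card (?R (Suc k) i) =
      card {M \<in> rook_placements (triangle s k). card M + i = Suc k} + card (?f ` ?D)"
    unfolding split
  proof (rule card_Un_disjoint)
    show "finite {M \<in> rook_placements (triangle s k). card M + i = Suc k}"
      using finite_rook_placements[OF finite_triangle] by auto
    show "finite (?f ` ?D)" using fin_R by auto
    show "{M \<in> rook_placements (triangle s k). card M + i = Suc k} \<inter> ?f ` ?D = {}"
      using new by auto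
  qed
  then show ?case unfolding old card_D by simp
qed

lemma card_rook_placements_converse:
  "card {M \<in> rook_placements (X\<inverse>). card M + i = k} = card {M \<in> rook_placements X. card M + i = k}"
proof -
  have na: "nonattacking (M\<inverse>) \<longleftrightarrow> nonattacking M" for M :: "('c \<times> 'd) set"
    by (auto simp: nonattacking_altdef)
  have "bij_betw converse {M \<in> rook_placements X. card M + i = k} {M \<in> rook_placements (X\<inverse>). card M + i = k}"
    by (rule bij_betw_byWitness[where f' = converse]) (auto simp: rook_placements_def na)
  then show ?thesis by (simp add: bij_betw_same_card)
qed

section \<open>Permutations with bounded displacement\<close>

text \<open>The condition is \<open>-k \<le> u i - i \<le> n - k\<close>, written additively because
  subtraction on \<open>nat\<close> truncates.\<close>

definition band_permutations :: "nat \<Rightarrow> nat \<Rightarrow> (nat \<Rightarrow> nat) set" where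
  "band_permutations n k = {u. u permutes {1..n} \<and> (\<forall>i\<in>{1..n}. i \<le> u i + k \<and> u i + k \<le> i + n)}"

lemma card_band_permutations:
  assumes "k \<le> n"
  shows "card (band_permutations n k) =
    (\<Sum>i = 0..k. Stirling (k + 1) (i + 1) * Stirling (n - k + 1) (i + 1) * (fact i)\<^sup>2)"
proof -
  define m where "m = n - k"
  have n: "n = m + k" using assms by (simp add: m_def)
  let ?T = "{1..k}" and ?B = "{k<..n}" and ?L = "{1..m}" and ?R = "{m<..n}"
  let ?X = "triangle m k" and ?Y = "(triangle k m)\<inverse>"
  let ?E = "{M \<in> perfect_matchings (?T \<union> ?B) (?L \<union> ?R). M \<inter> ?T \<times> ?R \<subseteq> ?X \<and> M \<inter> ?B \<times> ?L \<subseteq> ?Y}"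
  let ?graph = "\<lambda>u. (\<lambda>i. (i, u i)) ` {1..n}"
  have rows: "?T \<union> ?B = {1..n}" and cols: "?L \<union> ?R = {1..n}" using n by auto
  have graph: "bij_betw ?graph {u. u permutes {1..n}} (perfect_matchings {1..n} {1..n})"
    using bij_betw_graph_perfect_matchings[of id "{1..n}" "{1..n}"] by simp
  have band: "u \<in> band_permutations n k \<longleftrightarrow> ?graph u \<in> ?E" if u: "u permutes {1..n}" for u
  proof -
    have pm: "?graph u \<in> perfect_matchings {1..n} {1..n}"
      using graph u by (auto simp: bij_betw_def)
    have in_range: "u i \<in> {1..n}" if "i \<in> {1..n}" for i
      using u that by (simp only: permutes_in_image)
    \<comment> \<open>On \<open>?T \<times> ?L\<close> and \<open>?B \<times> ?R\<close> both bounds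
      are automatic, as \<open>n = m + k\<close>. On \<open>?T \<times> ?R\<close> only the upper
      bound can fail, on \<open>?B \<times> ?L\<close> only the lower one.\<close>
    have "(\<forall>i\<in>{1..n}. i \<le> u i + k \<and> u i + k \<le> i + n) \<longleftrightarrow>
        ?graph u \<inter> ?T \<times> ?R \<subseteq> ?X \<and> ?graph u \<inter> ?B \<times> ?L \<subseteq> ?Y"
    proof
      assume "\<forall>i\<in>{1..n}. i \<le> u i + k \<and> u i + k \<le> i + n"
      then show "?graph u \<inter> ?T \<times> ?R \<subseteq> ?X \<and> ?graph u \<inter> ?B \<times> ?L \<subseteq> ?Y"
        by (auto simp: triangle_def n)
    next
      assume sub: "?graph u \<inter> ?T \<times> ?R \<subseteq> ?X \<and> ?graph u \<inter> ?B \<times> ?L \<subseteq> ?Y"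
      show "\<forall>i\<in>{1..n}. i \<le> u i + k \<and> u i + k \<le> i + n"
      proof
        fix i assume i: "i \<in> {1..n}"
        have "(i, u i) \<in> ?graph u" using i by blast
        then have "i \<in> ?T \<and> u i \<in> ?R \<longrightarrow> (i, u i) \<in> ?X" "i \<in> ?B \<and> u i \<in> ?L \<longrightarrow> (i, u i) \<in> ?Y"
          using sub by blast+
        then show "i \<le> u i + k \<and> u i + k \<le> i + n"
          using i in_range[OF i] n by (auto simp: triangle_def)
      qed
    qed
    then show ?thesis using u pm unfolding rows cols by (simp add: band_permutations_def)
  qed
  have "?graph ` band_permutations n k = ?E"
  proof (intro equalityI subsetI)
    fix M assume "M \<in> ?graph ` band_permutations n k"
    then show "M \<in> ?E" using band by (auto simp: band_permutations_def)
  next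
    fix M assume M: "M \<in> ?E"
    then have "M \<in> perfect_matchings {1..n} {1..n}" by (simp only: rows cols mem_Collect_eq)
    then have "M \<in> ?graph ` {u. u permutes {1..n}}" using graph by (simp only: bij_betw_def)
    then obtain u where "u permutes {1..n}" "M = ?graph u" by blast
    then show "M \<in> ?graph ` band_permutations n k" using band M by blast
  qed
  moreover have "inj_on ?graph (band_permutations n k)"
    using graph by (auto simp: bij_betw_def band_permutations_def intro: inj_on_subset)
  ultimately have "card (band_permutations n k) = card ?E" using card_image by metis
  also have "\<dots> = (\<Sum>i = 0..k. card {M \<in> rook_placements ?X. card M + i = k} *
       card {M \<in> rook_placements ?Y. card M + i = m} * (fact i)\<^sup>2)"
    by (rule card_block_matchings) (auto simp: triangle_def n)
  finally show ?thesis
    by (simp only: card_rook_placements_triangle card_rook_placements_converse m_def)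
qed

subsection \<open>Bruhat order\<close>

text \<open>The inversions of \<open>u\<close> inject into those of
  \<open>u \<circ> transpose a b\<close> other than \<open>(a, b)\<close>. A pair moves along with
  the transposition if this keeps its order. The order is reversed only for \<open>(a, b)\<close>,
  no inversion of \<open>u\<close>, and for pairs joining \<open>a\<close> or \<open>b\<close> to a
  point between them; these stay inversions in place, since the value at \<open>a\<close> grows and
  the one at \<open>b\<close> shrinks.\<close>

lemma perm_length_less_comp_transpose:
  assumes ab: "1 \<le> a" "a < b" "b \<le> n" and less: "u a < u b"
  shows "perm_length n u < perm_length n (u \<circ> transpose a b)"
proof -
  let ?t = "transpose a b"
  let ?I = "\<lambda>v. {(i, j). 1 \<le> i \<and> i < j \<and> j \<le> n \<and> v i > v j}"
  let ?f = "\<lambda>(i, j). if ?t i < ?t j then (?t i, ?t j) else (i, j)"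
  have fin: "finite (?I v)" for v :: "nat \<Rightarrow> nat"
    by (rule finite_subset[of _ "{..n} \<times> {..n}"]) auto
  have t_range: "?t i \<in> {1..n} \<longleftrightarrow> i \<in> {1..n}" for i
    using ab by (intro permutes_in_image permutes_swap_id) auto
  have "?f (i, j) \<in> ?I (u \<circ> ?t) - {(a, b)}" if ij: "1 \<le> i" "i < j" "j \<le> n" "u j < u i" for i j
  proof (cases "?t i < ?t j")
    case True
    have "(?t i, ?t j) \<noteq> (a, b)"
    proof
      assume "(?t i, ?t j) = (a, b)"
      then have "i = b" "j = a" by (auto simp: transpose_eq_iff)
      then show False using ij ab by simp
    qed
    then show ?thesis using True ij t_range[of i] t_range[of j] by simp
  next
    case False
    then show ?thesis using ij ab less by (auto simp: transpose_def split: if_splits)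
  qed
  then have "?f ` ?I u \<subseteq> ?I (u \<circ> ?t) - {(a, b)}"
    by (intro image_subsetI) (simp only: mem_Collect_eq split_paired_all prod.case)
  \<comment> \<open>The transposition preserves the order of every moved image and reverses that of
    every kept pair, so the two kinds of image cannot coincide.\<close>
  moreover have "inj_on ?f (?I u)"
  proof (rule inj_onI)
    fix x y assume "x \<in> ?I u" "y \<in> ?I u" and eq: "?f x = ?f y"
    then obtain i j i' j' where xy: "x = (i, j)" "y = (i', j')" "i < j" "i' < j'" by auto
    show "x = y"
      using eq xy by (cases "?t i < ?t j"; cases "?t i' < ?t j'") (auto simp: transpose_eq_iff)
  qed
  ultimately have "perm_length n u \<le> card (?I (u \<circ> ?t) - {(a, b)})"
    unfolding perm_length_def using fin by (intro card_inj_on_le) auto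
  also have "\<dots> < perm_length n (u \<circ> ?t)"
    unfolding perm_length_def using ab less fin by (intro card_Diff1_less) auto
  finally show ?thesis .
qed

lemma perm_length_less_comp_transpose_iff:
  assumes u: "u permutes {1..n}" and ab: "1 \<le> a" "a < b" "b \<le> n"
  shows "perm_length n u < perm_length n (u \<circ> transpose a b) \<longleftrightarrow> u a < u b"
proof
  assume less: "perm_length n u < perm_length n (u \<circ> transpose a b)"
  show "u a < u b"
  proof (rule ccontr)
    assume "\<not> u a < u b"
    moreover have "u a \<noteq> u b" using u ab by (metis permutes_inj injD less_irrefl)
    ultimately have "(u \<circ> transpose a b) a < (u \<circ> transpose a b) b" by simp
    from perm_length_less_comp_transpose[OF ab this]
    have "perm_length n (u \<circ> transpose a b) < perm_length n u"
      by (simp only: comp_assoc transpose_comp_involutory comp_id)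
    then show False using less by simp
  qed
qed (use perm_length_less_comp_transpose[OF ab] in blast)

lemma permutes_comp_transpose:
  fixes a b n :: nat
  assumes "u permutes {1..n}" "1 \<le> a" "a < b" "b \<le> n"
  shows "u \<circ> transpose a b permutes {1..n}"
  using assms by (intro permutes_compose permutes_swap_id) auto

lemma bruhat_step_iff:
  "bruhat_step n u v \<longleftrightarrow>
     u permutes {1..n} \<and> (\<exists>a b. 1 \<le> a \<and> a < b \<and> b \<le> n \<and> u a < u b \<and> v = u \<circ> transpose a b)"
proof
  assume "bruhat_step n u v"
  then obtain a b where "u permutes {1..n}" "1 \<le> a" "a < b" "b \<le> n" "v = u \<circ> transpose a b"
    "perm_length n u < perm_length n v"
    by (auto simp only: bruhat_step_def sym_group_carrier sym_group_mult)
  then show "u permutes {1..n} \<and> (\<exists>a b. 1 \<le> a \<and> a < b \<and> b \<le> n \<and> u a < u b \<and> v = u \<circ> transpose a b)"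
    using perm_length_less_comp_transpose_iff[of u n a b] by metis
next
  assume "u permutes {1..n} \<and> (\<exists>a b. 1 \<le> a \<and> a < b \<and> b \<le> n \<and> u a < u b \<and> v = u \<circ> transpose a b)"
  then show "bruhat_step n u v"
    unfolding bruhat_step_def sym_group_carrier sym_group_mult
    by (metis perm_length_less_comp_transpose)
qed

lemma perm_length_le: "perm_length n u \<le> n * n"
proof -
  have "perm_length n u \<le> card ({1..n} \<times> {1..n})"
    unfolding perm_length_def by (rule card_mono) auto
  then show ?thesis by simp
qed

lemma strict_mono_on_permutes_eq_id:
  fixes n :: nat
  assumes x: "x permutes {1..n}" and mono: "\<And>a b. 1 \<le> a \<Longrightarrow> a < b \<Longrightarrow> b \<le> n \<Longrightarrow> x a < x b"
  shows "x = id"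
proof
  fix i
  have ge: "i \<le> x i" if "1 \<le> i" "i \<le> n" for i
    using that
  proof (induction i)
    case (Suc i)
    show ?case
    proof (cases "i = 0")
      case True
      then show ?thesis using Suc permutes_in_image[OF x, of 1] by auto
    next
      case False
      then show ?thesis using Suc mono[of i "Suc i"] by auto
    qed
  qed simp
  have "x i \<le> i" if i: "1 \<le> i" "i \<le> n" for i
  proof -
    have "x ` {i..n} \<subseteq> {x i..n}"
    proof clarify
      fix j assume "j \<in> {i..n}"
      then show "x j \<in> {x i..n}"
        using mono[of i j] i permutes_in_image[OF x, of j] by (cases "i = j") auto
    qed
    then have "card {i..n} \<le> card {x i..n}"
      by (metis card_image card_mono finite_atLeastAtMost inj_on_subset permutes_inj subset_UNIV x)
    then show ?thesis using i ge[OF i] by simp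
  qed
  then show "x i = id i"
    using ge[of i] x by (cases "i \<in> {1..n}") (auto simp: permutes_not_in intro: antisym)
qed

lemma bruhat_le_id:
  assumes "x permutes {1..n}"
  shows "bruhat_le n id x"
  using assms
proof (induction "perm_length n x" arbitrary: x rule: less_induct)
  case less
  show ?case
  proof (cases "x = id")
    case True
    then show ?thesis by (simp add: bruhat_le_def)
  next
    case False
    then obtain a b where ab: "1 \<le> a" "a < b" "b \<le> n" "\<not> x a < x b"
      using strict_mono_on_permutes_eq_id less.prems by blast
    then have gt: "x b < x a"
      using less.prems by (metis permutes_inj injD linorder_neqE_nat less_irrefl)
    let ?y = "x \<circ> transpose a b"
    have y: "?y permutes {1..n}" using permutes_comp_transpose less.prems ab by blast
    have x: "x = ?y \<circ> transpose a b" by (simp add: comp_assoc)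
    have "bruhat_step n ?y x"
      unfolding bruhat_step_iff using y ab gt x by (intro conjI exI[of _ a] exI[of _ b]) simp_all
    moreover from this have "bruhat_le n id ?y"
      by (intro less.hyps y) (simp add: bruhat_step_def)
    ultimately show ?thesis unfolding bruhat_le_def by (rule rtranclp.rtrancl_into_rtrancl[rotated])
  qed
qed

section \<open>Displacement bounds along Bruhat steps\<close>

text \<open>The lower bound at \<open>a\<close> follows from
  \<open>a < b \<le> v b + k = u a + k\<close>, the upper bound at \<open>b\<close> from
  \<open>u b + k = v a + k \<le> a + n < b + n\<close>; the other two are inherited through
  \<open>u a < u b\<close>.\<close>

lemma band_permutations_bruhat_step:
  assumes "bruhat_step n u v" "v \<in> band_permutations n k"
  shows "u \<in> band_permutations n k"
proof -
  obtain a b where u: "u permutes {1..n}" and ab: "1 \<le> a" "a < b" "b \<le> n" "u a < u b"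
    and v: "v = u \<circ> transpose a b"
    using assms(1) by (auto simp: bruhat_step_iff)
  have band: "i \<le> v i + k" "v i + k \<le> i + n" if "i \<in> {1..n}" for i
    using assms(2) that by (auto simp: band_permutations_def)
  have "i \<le> u i + k \<and> u i + k \<le> i + n" if i: "i \<in> {1..n}" for i
    using band[of i] band[of a] band[of b] ab i
    by (cases "i = a"; cases "i = b") (auto simp: v)
  then show ?thesis using u by (simp add: band_permutations_def)
qed

lemma bruhat_le_band_permutations:
  assumes "bruhat_le n u v" "v \<in> band_permutations n k"
  shows "u \<in> band_permutations n k"
  using assms unfolding bruhat_le_def
  by (induction rule: converse_rtranclp_induct) (auto intro: band_permutations_bruhat_step)

locale top_grassmannian =
  fixes n k :: nat and w :: "nat \<Rightarrow> nat"
  assumes k: "1 \<le> k" "k < n" and w: "w permutes {1..n}"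
    and w_low: "\<And>i. 1 \<le> i \<Longrightarrow> i \<le> k \<Longrightarrow> w i = n - k + i"
    and w_high: "\<And>i. k + 1 \<le> i \<Longrightarrow> i \<le> n \<Longrightarrow> w i = i - k"
begin

lemma w_in_band: "w \<in> band_permutations n k"
proof -
  have "i \<le> w i + k \<and> w i + k \<le> i + n" if "i \<in> {1..n}" for i
    using that k w_low[of i] w_high[of i] by (cases "i \<le> k") auto
  then show ?thesis using w by (simp add: band_permutations_def)
qed

text \<open>The map \<open>p = w\<inverse> \<circ> u\<close> moves \<open>i\<close> up if \<open>u i \<le> n - k\<close> and down otherwise. Swapping
  the values at the largest excedance \<open>a\<close> of \<open>p\<close> and at the next point \<open>b\<close> not fixed by \<open>p\<close>
  stays in the band because \<open>p b \<le> a < b \<le> p a\<close>.\<close>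

lemma band_permutations_step:
  assumes u: "u \<in> band_permutations n k" and ne: "u \<noteq> w"
  shows "\<exists>v. bruhat_step n u v \<and> v \<in> band_permutations n k"
proof -
  have perm: "u permutes {1..n}" using u by (simp add: band_permutations_def)
  have band: "i \<le> u i + k" "u i + k \<le> i + n" if "i \<in> {1..n}" for i
    using u that by (auto simp: band_permutations_def)
  have range: "u i \<in> {1..n}" if "i \<in> {1..n}" for i
    using perm that by (simp only: permutes_in_image)
  \<comment> \<open>The inverse of \<open>w\<close> in closed form: a value
    \<open>c \<le> n - k\<close> sits at position \<open>c + k\<close>, a larger one at
    \<open>c + k - n\<close>.\<close>
  define p where "p i = (if u i \<le> n - k then u i + k else u i + k - n)" for i
  have p_range: "p i \<in> {1..n}" if "i \<in> {1..n}" for i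
    using range[OF that] k by (auto simp: p_def)
  have p_inj: "i = j" if "i \<in> {1..n}" "j \<in> {1..n}" "p i = p j" for i j
  proof -
    have "u i = u j"
      using that(3) range[OF that(1)] range[OF that(2)] k by (auto simp: p_def split: if_splits)
    then show ?thesis using perm by (metis permutes_inj injD)
  qed
  \<comment> \<open>The band enters here: its lower bound gives \<open>i \<le> p i\<close> for small
    values, its upper bound \<open>p i \<le> i\<close> for large ones.\<close>
  have up: "u i \<le> n - k \<longleftrightarrow> i < p i" if "i \<in> {1..n}" "p i \<noteq> i" for i
    using that band[OF that(1)] k by (auto simp: p_def split: if_splits)
  have "\<exists>i\<in>{1..n}. p i \<noteq> i"
  proof (rule ccontr)
    assume "\<not> ?thesis"
    then have fixed: "p i = i" if "i \<in> {1..n}" for i using that by blast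
    have "u i = w i" for i
    proof (cases "i \<in> {1..n}")
      case True
      then show ?thesis
        using fixed[OF True] range[OF True] w_low[of i] w_high[of i] k
        by (cases "i \<le> k") (auto simp: p_def split: if_splits)
    next
      case False
      then show ?thesis using perm w by (simp add: permutes_not_in)
    qed
    then show False using ne by blast
  qed
  then obtain i0 where i0: "i0 \<in> {1..n}" "p i0 \<noteq> i0"
    and i0_min: "\<And>i. i \<in> {1..n} \<Longrightarrow> p i \<noteq> i \<Longrightarrow> i0 \<le> i"
    using ex_has_least_nat[of "\<lambda>i. i \<in> {1..n} \<and> p i \<noteq> i" _ "\<lambda>i. i"] by blast
  \<comment> \<open>All points below the least moved point are fixed, so by injectivity
    \<open>p\<close> cannot send it down. This provides an excedance.\<close>
  have "i0 < p i0"
  proof (rule ccontr)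
    assume "\<not> i0 < p i0"
    then have lt: "p i0 < i0" using i0 by simp
    then have "p (p i0) = p i0" using i0_min[OF p_range[OF i0(1)]] by force
    then show False using p_inj[OF p_range[OF i0(1)] i0(1)] i0 by simp
  qed
  define a where "a = Max {i \<in> {1..n}. i < p i}"
  have "a \<in> {i \<in> {1..n}. i < p i}"
    unfolding a_def using i0(1) \<open>i0 < p i0\<close> by (intro Max_in) auto
  then have a: "a \<in> {1..n}" "a < p a" by auto
  have a_max: "i \<le> a" if "i \<in> {1..n}" "i < p i" for i
    unfolding a_def using that by (intro Max_ge) auto
  \<comment> \<open>By injectivity \<open>p a\<close> is not fixed either, so there is a moved point
    beyond \<open>a\<close>, and the least one satisfies \<open>b \<le> p a\<close>.\<close>
  have pa: "p a \<in> {1..n}" "a < p a" "p (p a) \<noteq> p a"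
    using p_range[OF a(1)] p_inj[OF p_range[OF a(1)] a(1)] a(2) by auto
  then obtain b where b: "b \<in> {1..n}" "a < b" "p b \<noteq> b"
    and b_min: "\<And>i. i \<in> {1..n} \<Longrightarrow> a < i \<Longrightarrow> p i \<noteq> i \<Longrightarrow> b \<le> i"
    using ex_has_least_nat[of "\<lambda>i. i \<in> {1..n} \<and> a < i \<and> p i \<noteq> i" "p a" "\<lambda>i. i"] by blast
  have b_le: "b \<le> p a" using b_min pa by blast
  have pb_less: "p b < b" using a_max[OF b(1)] b by force
  \<comment> \<open>If \<open>p b\<close> lay strictly between \<open>a\<close> and
    \<open>b\<close>, it would be fixed by the choice of \<open>b\<close>, against
    injectivity.\<close>
  have pb_le: "p b \<le> a"
  proof (rule ccontr)
    assume "\<not> p b \<le> a"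
    then have "p (p b) = p b" using b_min[OF p_range[OF b(1)]] pb_less by force
    then show False using p_inj[OF p_range[OF b(1)] b(1)] b(3) by simp
  qed
  have ua: "u a \<le> n - k" using up[OF a(1)] a(2) by simp
  have ub: "\<not> u b \<le> n - k" using up[OF b(1,3)] pb_less by simp
  \<comment> \<open>These are the two bounds that the swap endangers: the value at \<open>b\<close>
    shrinks and the one at \<open>a\<close> grows.\<close>
  have low: "b \<le> u a + k" using b_le ua by (simp add: p_def)
  have high: "u b + k \<le> a + n" using pb_le ub by (simp add: p_def)
  let ?v = "u \<circ> transpose a b"
  have "bruhat_step n u ?v"
    unfolding bruhat_step_iff
    using perm a b ua ub by (intro conjI exI[of _ a] exI[of _ b]) auto
  moreover have "?v \<in> band_permutations n k"
  proof -
    have "i \<le> ?v i + k \<and> ?v i + k \<le> i + n" if i: "i \<in> {1..n}" for i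
      using band[OF i] band[OF a(1)] band[OF b(1)] low high b(2)
      by (cases "i = a"; cases "i = b") auto
    then show ?thesis
      using permutes_comp_transpose[OF perm, of a b] a b by (simp add: band_permutations_def)
  qed
  ultimately show ?thesis by blast
qed

lemma band_permutations_bruhat_le:
  assumes "u \<in> band_permutations n k"
  shows "bruhat_le n u w"
  using assms
\<comment> \<open>Each step up raises the length, which never exceeds \<open>n * n\<close>.\<close>
proof (induction "n * n - perm_length n u" arbitrary: u rule: less_induct)
  case less
  show ?case
  proof (cases "u = w")
    case True
    then show ?thesis by (simp add: bruhat_le_def)
  next
    case False
    then obtain v where v: "bruhat_step n u v" "v \<in> band_permutations n k"
      using band_permutations_step less.prems by blast
    then have "perm_length n u < perm_length n v" by (simp add: bruhat_step_def)
    then have "bruhat_le n v w"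
      using less.hyps[OF _ v(2)] perm_length_le[of n v] by simp
    then show ?thesis using v(1) unfolding bruhat_le_def by simp
  qed
qed

lemma bruhat_interval_id_w: "bruhat_interval n id w = band_permutations n k"
proof (intro equalityI subsetI)
  fix u assume "u \<in> bruhat_interval n id w"
  then show "u \<in> band_permutations n k"
    using bruhat_le_band_permutations[OF _ w_in_band] by (simp add: bruhat_interval_def)
next
  fix u assume u: "u \<in> band_permutations n k"
  then have "u permutes {1..n}" by (simp add: band_permutations_def)
  then show "u \<in> bruhat_interval n id w"
    using band_permutations_bruhat_le[OF u] bruhat_le_id
    by (simp add: bruhat_interval_def sym_group_carrier)
qed

section \<open>Minimal coset representatives\<close>

text \<open>A generator with \<open>i \<noteq> k\<close> exchanges two positions on the same side of
  the cut between \<open>k\<close> and \<open>k + 1\<close>.\<close>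

lemma parabolic_preserves_blocks:
  assumes "p \<in> parabolic n ({1..n - 1} - {k})"
  shows "p permutes {1..n} \<and> p ` {1..k} = {1..k}"
  using assms unfolding parabolic_def
proof (induction rule: generate.induct)
  case one
  show ?case unfolding sym_group_one by (intro conjI permutes_id) simp
next
  have adj: "h permutes {1..n} \<and> h ` {1..k} = {1..k}" if "h \<in> adj_transp ` ({1..n - 1} - {k})" for h
  proof -
    from that obtain i where "i \<in> {1..n - 1} - {k}" and "h = adj_transp i" by (rule imageE)
    then have i: "1 \<le> i" "i \<le> n - 1" "i \<noteq> k" and h: "h = transpose i (i + 1)"
      by (auto simp: adj_transp_def)
    have "h permutes {1..n}" unfolding h using i k by (intro permutes_swap_id) auto
    moreover have "h ` {1..k} = {1..k}"
    proof (cases "i < k")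
      case True
      then have "h permutes {1..k}" unfolding h using i by (intro permutes_swap_id) auto
      then show ?thesis by (rule permutes_image)
    next
      case False
      then have "h j = j" if "j \<in> {1..k}" for j
        using that i by (auto simp: h transpose_def)
      then show ?thesis by simp
    qed
    ultimately show ?thesis by blast
  qed
  {
    case (incl h)
    then show ?case by (rule adj)
  next
    case (inv h)
    note h = adj[OF inv]
    then have "inv' h ` {1..k} = {1..k}"
      by (metis bij_def image_inv_f_f permutes_bij)
    then show ?case
      using h permutes_inv[of h "{1..n}"] by (simp add: sym_group_carrier)
  }
next
  case (eng p q)
  then show ?case
    by (simp only: sym_group_mult image_comp[symmetric]) (blast intro: permutes_compose)
qed

text \<open>The inversions of \<open>w\<close> are exactly the pairs with
  \<open>i \<le> k < j\<close>. Composing with a permutation that preserves \<open>{1..k}\<close>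
  keeps all of them inverted, so no element of the coset has fewer inversions.\<close>

lemma w_in_min_left_coset_reps: "w \<in> min_left_coset_reps n ({1..n - 1} - {k})"
proof -
  have "perm_length n w \<le> perm_length n (w \<circ> p)" if "p \<in> parabolic n ({1..n - 1} - {k})" for p
  proof -
    have p: "p permutes {1..n}" "p ` {1..k} = {1..k}"
      using parabolic_preserves_blocks[OF that] by auto
    have low: "p i \<in> {1..k}" if "i \<in> {1..k}" for i using p(2) that by blast
    have high: "p j \<in> {k + 1..n}" if j: "j \<in> {k + 1..n}" for j
    proof -
      have "p j \<notin> {1..k}"
      proof
        assume "p j \<in> {1..k}"
        then obtain i where "i \<in> {1..k}" "p i = p j" using p(2) by (metis imageE)
        then show False using j p(1) by (metis permutes_inj injD atLeastAtMost_iff not_less_eq_eq Suc_eq_plus1)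
      qed
      moreover have "p j \<in> {1..n}" using j permutes_in_image[OF p(1), of j] by auto
      ultimately show ?thesis by auto
    qed
    have "(i \<le> k \<and> k < j)" if "1 \<le> i" "i < j" "j \<le> n" "w j < w i" for i j
    proof (rule ccontr)
      assume "\<not> (i \<le> k \<and> k < j)"
      then consider "j \<le> k" | "k < i" using that by linarith
      then show False
      proof cases
        case 1
        then show False using that w_low[of i] w_low[of j] by simp
      next
        case 2
        then show False using that w_high[of i] w_high[of j] by simp
      qed
    qed
    moreover have "w (p j) < w (p i)" if "1 \<le> i" "i \<le> k" "k < j" "j \<le> n" for i j
      using that low[of i] high[of j] w_low[of "p i"] w_high[of "p j"] k by auto
    ultimately show ?thesis
      unfolding perm_length_def
      by (intro card_mono) (auto intro: finite_subset[of _ "{..n} \<times> {..n}"])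
  qed
  then show ?thesis
    using w by (auto simp: min_left_coset_reps_def l_coset_def sym_group_mult sym_group_carrier)
qed

text \<open>Yields the maximality of \<open>w\<close>, since the band lies below \<open>w\<close>. A
  descent at \<open>i \<noteq> k\<close> could be removed within the coset, so \<open>v\<close>
  increases on \<open>{1..k}\<close> and on \<open>{k + 1..n}\<close>; going down from
  \<open>v k \<le> n\<close> and up from \<open>1 \<le> v (k + 1)\<close> gives the bounds.\<close>

lemma min_left_coset_reps_subset_band:
  assumes v: "v \<in> min_left_coset_reps n ({1..n - 1} - {k})"
  shows "v \<in> band_permutations n k"
proof -
  have perm: "v permutes {1..n}"
    using v by (simp add: min_left_coset_reps_def sym_group_carrier)
  have ascent: "v i < v (Suc i)" if i: "1 \<le> i" "i \<le> n - 1" "i \<noteq> k" for i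
  proof -
    have "adj_transp i \<in> parabolic n ({1..n - 1} - {k})"
      unfolding parabolic_def using i by (intro generate.incl) auto
    then have "perm_length n v \<le> perm_length n (v \<circ> transpose i (Suc i))"
      using v by (auto simp: min_left_coset_reps_def l_coset_def sym_group_mult adj_transp_def)
    moreover have "(v \<circ> transpose i (Suc i)) \<circ> transpose i (Suc i) = v" by (simp add: comp_assoc)
    ultimately have "\<not> v (Suc i) < v i"
      using perm_length_less_comp_transpose[of i "Suc i" n "v \<circ> transpose i (Suc i)"] i by force
    moreover have "v (Suc i) \<noteq> v i" using perm by (metis permutes_inj injD n_not_Suc_n)
    ultimately show ?thesis by simp
  qed
  have range: "v i \<in> {1..n}" if "i \<in> {1..n}" for i
    using perm that by (simp only: permutes_in_image)
  have low: "v i + (k - i) \<le> n" if "1 \<le> i" "i \<le> k" for i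
    using that(2,1)
  proof (induction rule: inc_induct)
    case base
    then show ?case using range[of k] k by simp
  next
    case (step i)
    then have "v i < v (Suc i)" using k by (intro ascent) auto
    then show ?case using step by simp
  qed
  have high: "i \<le> v i + k" if "k + 1 \<le> i" "i \<le> n" for i
    using that
  proof (induction rule: dec_induct)
    case base
    then show ?case using range[of "k + 1"] k by simp
  next
    case (step i)
    then have "v i < v (Suc i)" using k by (intro ascent) auto
    then show ?case using step by simp
  qed
  have "i \<le> v i + k \<and> v i + k \<le> i + n" if i: "i \<in> {1..n}" for i
    using i range[OF i] low[of i] high[of i] k by (cases "i \<le> k") auto
  then show ?thesis using perm by (simp add: band_permutations_def)
qed

end

theorem theorem3p5:
  fixes n k :: nat and w :: "nat \<Rightarrow> nat"
  assumes "1 \<le> k" and "k \<le> n - 1"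
    and "w \<in> carrier (sym_group n)"
    and "\<And>i. 1 \<le> i \<Longrightarrow> i \<le> k \<Longrightarrow> w i = n - k + i"
    and "\<And>i. k + 1 \<le> i \<Longrightarrow> i \<le> n \<Longrightarrow> w i = i - k"
  shows "w \<in> min_left_coset_reps n ({1..n - 1} - {k}) \<and>
         (\<forall>v \<in> min_left_coset_reps n ({1..n - 1} - {k}). bruhat_le n v w) \<and>
         card (bruhat_interval n id w) =
           (\<Sum>i = 0..k. Stirling (k + 1) (i + 1) * Stirling (n - k + 1) (i + 1) * (fact i)\<^sup>2) \<and>
         int (card (bruhat_interval n id w)) =
           (-1) ^ k * (\<Sum>i = 0..k. (-1) ^ i * (int i + 1) ^ (n - k) * fact i * int (Stirling k i)) \<and>
         rat_of_nat (card (bruhat_interval n id w)) = poly_bernoulli (int k - int n) k"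
proof -
  interpret top_grassmannian n k w
    using assms by unfold_locales (auto simp: sym_group_carrier)
  have card: "card (bruhat_interval n id w) =
      (\<Sum>i = 0..k. Stirling (k + 1) (i + 1) * Stirling (n - k + 1) (i + 1) * (fact i)\<^sup>2)"
    unfolding bruhat_interval_id_w using k by (intro card_band_permutations) simp
  then have alt: "int (card (bruhat_interval n id w)) =
      (-1) ^ k * (\<Sum>i = 0..k. (-1) ^ i * (int i + 1) ^ (n - k) * fact i * int (Stirling k i))"
    by (simp only: Stirling_sum_eq_alternating_sum)
  have "poly_bernoulli (int k - int n) k = poly_bernoulli (- int (n - k)) k"
    using k by (simp add: of_nat_diff)
  also have "\<dots> = of_int (int (card (bruhat_interval n id w)))"
    unfolding alt by (rule poly_bernoulli_neg_eq)
  finally have "rat_of_nat (card (bruhat_interval n id w)) = poly_bernoulli (int k - int n) k"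
    by simp
  then show ?thesis
    using card alt w_in_min_left_coset_reps min_left_coset_reps_subset_band band_permutations_bruhat_le
    by blast
qed

end
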